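(* Let $a>0$. For all sufficiently large $n$ (of the form $n=2^\ell$), every circuit $C(f)$ with at most $n^a$ oracle gates for $f$, all nested less than $\sqrt{n}$ deep, fails to compute $F$ for some 1-Lipschitz function $f:\{0,1\}^{m\ell+n}\to\{0,1\}^n$; that is, there is a 1-Lipschitz $f$ such that the output of $C(f)$ differs from $F(f)$.
   Context: Let $n=2^\ell$ and $m=2n+1$. For $f:\{0,1\}^{m\ell+n}\to\{0,1\}^n$ and $T\in\{0,1\}^\ell$ (also viewed as a number $0\le T<n$ in binary, with $\mathrm{Bit}(T,1)$ the least significant bit), define $f_T(X)=f(\mathrm{Bit}(T,1)^{m}\cdots\mathrm{Bit}(T,\ell)^{m}X)$ for $|X|=n$, where $b^{m}$ is bit $b$ repeated $m$ times. Define $X_0=0^n$ and $X_{T+1}=f_T(X_T)$, and $F=F(f)=\mathrm{Bit}(X_{\lfloor\sqrt n\rfloor},1)$. A circuit $C(f)$ may contain any number of Boolean gates together with oracle gates computing $f$; the nesting depth of an oracle gate is the maximum number of oracle gates (including itself) on any path from a circuit input to it. $f$ is 1-Lipschitz if inputs at Hamming distance $1$ have outputs at Hamming distance at most $1$.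
   Formalization: "Nested less than √n deep" is read as nesting depth less than ⌊√n⌋; for odd ℓ and a ≥ 1/2 the unrounded claim is false, since the direct circuit computing X_1,…,X_{⌊√n⌋} has nesting depth ⌊√n⌋ < √n and computes F. *)

theory Defs
  imports Complex_Main "HOL-Library.FuncSet"
begin

definition cube :: "nat \<Rightarrow> bool list set" where
  "cube N = {x. length x = N}"

definition hamming :: "bool list \<Rightarrow> bool list \<Rightarrow> nat" where
  "hamming x y = card {i. i < length x \<and> x ! i \<noteq> y ! i}"

definition one_lipschitz :: "nat \<Rightarrow> (bool list \<Rightarrow> bool list) \<Rightarrow> bool" where
  "one_lipschitz N f \<longleftrightarrow>
     (\<forall>x\<in>cube N. \<forall>y\<in>cube N. hamming x y = 1 \<longrightarrow> hamming (f x) (f y) \<le> 1)"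


text \<open>The list representing a string \<open>X\<close> is \<open>[Bit X 1, Bit X 2, \<dots>]\<close>; for strings that
  represent numbers the least significant bit comes first.\<close>

definition Bit :: "bool list \<Rightarrow> nat \<Rightarrow> bool" where
  "Bit X i = X ! (i - 1)"

definition binary :: "nat \<Rightarrow> nat \<Rightarrow> bool list" where
  "binary l T = map (bit T) [0..<l]"

text \<open>Everything is parametrised by \<open>l\<close>, with \<open>n = 2 ^ l\<close> and \<open>m = 2 * n + 1\<close>.\<close>

definition rep_len :: "nat \<Rightarrow> nat" where
  "rep_len l = 2 * 2 ^ l + 1"

definition in_len :: "nat \<Rightarrow> nat" where
  "in_len l = rep_len l * l + 2 ^ l"

definition slice :: "nat \<Rightarrow> (bool list \<Rightarrow> bool list) \<Rightarrow> bool list \<Rightarrow> bool list \<Rightarrow> bool list" where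
  "slice l f T X =
     f (concat (map (\<lambda>i. replicate (rep_len l) (Bit T i)) [1..<Suc l]) @ X)"

primrec iterate :: "nat \<Rightarrow> (bool list \<Rightarrow> bool list) \<Rightarrow> nat \<Rightarrow> bool list" where
  "iterate l f 0 = replicate (2 ^ l) False"
| "iterate l f (Suc T) = slice l f (binary l T) (iterate l f T)"

definition F :: "nat \<Rightarrow> (bool list \<Rightarrow> bool list) \<Rightarrow> bool" where
  "F l f = Bit (iterate l f (nat \<lfloor>sqrt (2 ^ l)\<rfloor>)) 1"


text \<open>A circuit is a topologically sorted list of gates with a designated output wire.
  Oracle gates have several output bits, so a wire \<open>(j, k)\<close> carries bit \<open>k\<close> (counted from
  \<open>0\<close>) of the output of gate \<open>j\<close>.  The function \<open>F\<close> has no argument besides \<open>f\<close>, hence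
  the circuit inputs are fixed bits.  A Boolean gate may compute any Boolean function of any
  positive fan-in.\<close>

type_synonym wire = "nat \<times> nat"

datatype gate =
    InputBit bool
  | BoolGate "bool list \<Rightarrow> bool" "wire list"
  | OracleGate "wire list"

type_synonym circuit = "gate list \<times> wire"

primrec gate_wires :: "gate \<Rightarrow> wire list" where
  "gate_wires (InputBit b) = []"
| "gate_wires (BoolGate g ws) = ws"
| "gate_wires (OracleGate ws) = ws"

primrec gate_width :: "nat \<Rightarrow> gate \<Rightarrow> nat" where
  "gate_width n (InputBit b) = 1"
| "gate_width n (BoolGate g ws) = 1"
| "gate_width n (OracleGate ws) = n"

primrec gate_arity_ok :: "nat \<Rightarrow> gate \<Rightarrow> bool" where
  "gate_arity_ok N (InputBit b) = True"
| "gate_arity_ok N (BoolGate g ws) = (ws \<noteq> [])"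
| "gate_arity_ok N (OracleGate ws) = (length ws = N)"

text \<open>\<open>wf_circuit N n C\<close>: \<open>C\<close> is a circuit over oracles from \<open>cube N\<close> to \<open>cube n\<close>.\<close>

definition wf_circuit :: "nat \<Rightarrow> nat \<Rightarrow> circuit \<Rightarrow> bool" where
  "wf_circuit N n C \<longleftrightarrow> (case C of (gs, out) \<Rightarrow>
     (\<forall>i<length gs. gate_arity_ok N (gs ! i) \<and>
        (\<forall>(j, k)\<in>set (gate_wires (gs ! i)). j < i \<and> k < gate_width n (gs ! j))) \<and>
     fst out < length gs \<and> snd out < gate_width n (gs ! fst out))"

definition wire_value :: "bool list list \<Rightarrow> wire \<Rightarrow> bool" where
  "wire_value vs w = vs ! fst w ! snd w"

primrec gate_value :: "(bool list \<Rightarrow> bool list) \<Rightarrow> bool list list \<Rightarrow> gate \<Rightarrow> bool list" where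
  "gate_value f vs (InputBit b) = [b]"
| "gate_value f vs (BoolGate g ws) = [g (map (wire_value vs) ws)]"
| "gate_value f vs (OracleGate ws) = f (map (wire_value vs) ws)"

definition gate_values :: "(bool list \<Rightarrow> bool list) \<Rightarrow> gate list \<Rightarrow> bool list list" where
  "gate_values f gs = foldl (\<lambda>vs g. vs @ [gate_value f vs g]) [] gs"

definition circuit_output :: "circuit \<Rightarrow> (bool list \<Rightarrow> bool list) \<Rightarrow> bool" where
  "circuit_output C f = wire_value (gate_values f (fst C)) (snd C)"

definition is_oracle :: "circuit \<Rightarrow> nat \<Rightarrow> bool" where
  "is_oracle C i \<longleftrightarrow> (\<exists>ws. fst C ! i = OracleGate ws)"

definition is_input :: "circuit \<Rightarrow> nat \<Rightarrow> bool" where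
  "is_input C i \<longleftrightarrow> (\<exists>b. fst C ! i = InputBit b)"

definition oracle_gates :: "circuit \<Rightarrow> nat set" where
  "oracle_gates C = {i. i < length (fst C) \<and> is_oracle C i}"

definition feeds :: "circuit \<Rightarrow> nat \<Rightarrow> nat \<Rightarrow> bool" where
  "feeds C j i \<longleftrightarrow> j \<in> fst ` set (gate_wires (fst C ! i))"

definition input_paths :: "circuit \<Rightarrow> nat \<Rightarrow> nat list set" where
  "input_paths C i = {p. p \<noteq> [] \<and> set p \<subseteq> {..<length (fst C)} \<and> successively (feeds C) p \<and>
     is_input C (hd p) \<and> last p = i}"

definition nesting_depth :: "circuit \<Rightarrow> nat \<Rightarrow> nat" where
  "nesting_depth C i = Max ((\<lambda>p. length (filter (is_oracle C) p)) ` input_paths C i)"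


text \<open>The maximum above is taken over a finite nonempty set.\<close>

lemma finite_input_paths:
  assumes "wf_circuit N n C"
  shows "finite (input_paths C i)"
proof (rule finite_subset)
  let ?L = "{p. set p \<subseteq> {..<length (fst C)} \<and> length p \<le> length (fst C)}"
  show "finite ?L" by (rule finite_lists_length_le) simp
  show "input_paths C i \<subseteq> ?L"
  proof
    fix p assume p: "p \<in> input_paths C i"
    have less: "j < k" if "feeds C j k" "k < length (fst C)" for j k
      using that assms unfolding feeds_def wf_circuit_def by (fastforce split: prod.splits)
    have "successively (<) p"
      using p less unfolding input_paths_def
      by (auto intro: successively_mono)
    then have "distinct p"
      by (simp add: successively_conv_sorted_wrt strict_sorted_iff)
    then have "length p = card (set p)" by (simp add: distinct_card)
    also have "\<dots> \<le> card {..<length (fst C)}"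
      using p by (intro card_mono) (auto simp: input_paths_def)
    finally show "p \<in> ?L" using p by (auto simp: input_paths_def)
  qed
qed

lemma input_paths_nonempty:
  assumes "wf_circuit N n C" "N > 0" "i < length (fst C)"
  shows "input_paths C i \<noteq> {}"
  using assms(3)
proof (induction i rule: less_induct)
  case (less i)
  show ?case
  proof (cases "gate_wires (fst C ! i) = []")
    case True
    have "gate_arity_ok N (fst C ! i)"
      using assms(1) less.prems by (auto simp: wf_circuit_def split: prod.splits)
    with True \<open>N > 0\<close> have "is_input C i"
      by (cases "fst C ! i") (auto simp: is_input_def)
    then have "[i] \<in> input_paths C i"
      using less.prems by (simp add: input_paths_def)
    then show ?thesis by blast
  next
    case False
    then obtain j where j: "feeds C j i"
      unfolding feeds_def by (metis ex_in_conv image_is_empty set_empty)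
    then have "j < i"
      using assms(1) less.prems unfolding feeds_def wf_circuit_def
      by (fastforce split: prod.splits)
    with less.IH less.prems obtain p where "p \<in> input_paths C j" by fastforce
    then have "p @ [i] \<in> input_paths C i"
      using j less.prems by (auto simp: input_paths_def successively_append_iff)
    then show ?thesis by blast
  qed
qed

end

theory Submission imports Defs begin

text \<open>An adversary argument.  The strings \<open>X\<^sub>1, X\<^sub>2, \<dots>\<close> are chosen one after the other, with
  supports of slowly decreasing size, and near the encoding of \<open>(T, X\<^sub>T)\<close> the oracle answers
  with \<open>X\<^sub>T\<^sub>+\<^sub>1\<close>, one element of its support being erased per unit of Hamming distance.  Such an
  oracle is 1-Lipschitz, as encodings of different times are more than \<open>2 n\<close> apart, and it
  reveals nothing about \<open>X\<^sub>T\<^sub>+\<^sub>1\<close> at distance at least \<open>|X\<^sub>T\<^sub>+\<^sub>1|\<close>.  A query asked without knowledge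
  of \<open>X\<^sub>T\<close> is, for a suitable \<open>X\<^sub>T\<close>, at distance at least \<open>|X\<^sub>T| - r\<close> from it, where the
  constant \<open>r\<close> depends only on the exponent \<open>a\<close>; this holds for polynomially many queries
  simultaneously.  As the sizes decrease by \<open>r\<close> per step, queries of depth at most \<open>T\<close> do not
  see \<open>X\<^sub>T\<^sub>+\<^sub>1\<close>, so a circuit of depth less than \<open>\<lfloor>sqrt n\<rfloor>\<close> cannot depend on the last string.
  The initial size \<open>r \<lfloor>sqrt n\<rfloor>\<close> is small enough to leave a block of \<open>z\<^sup>2\<close> positions for each
  element of the support, with \<open>z\<close> a power of \<open>n\<close>.\<close>

section \<open>Hamming distance and separation of the time prefixes\<close>

lemma hamming_commute:
  "length x = length y \<Longrightarrow> hamming x y = hamming y x"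
  unfolding hamming_def by (metis (no_types, lifting))

lemma hamming_triangle:
  assumes "length x = length y"
  shows "hamming x z \<le> hamming x y + hamming y z"
proof -
  have "hamming x z \<le> card ({i. i < length x \<and> x ! i \<noteq> y ! i} \<union> {i. i < length y \<and> y ! i \<noteq> z ! i})"
    unfolding hamming_def using assms by (intro card_mono) auto
  also have "\<dots> \<le> hamming x y + hamming y z"
    unfolding hamming_def by (rule card_Un_le)
  finally show ?thesis .
qed

lemma hamming_self: "hamming x x = 0"
  by (simp add: hamming_def)

lemma hamming_append_ge:
  assumes "length q = length p + length y"
  shows "card {k. k < length y \<and> q ! (length p + k) \<noteq> y ! k} \<le> hamming q (p @ y)"
proof -
  let ?D = "{k. k < length y \<and> q ! (length p + k) \<noteq> y ! k}"
  have "card ?D = card ((+) (length p) ` ?D)"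
    by (simp add: card_image)
  also have "\<dots> \<le> hamming q (p @ y)"
    unfolding hamming_def using assms by (intro card_mono) (auto simp: nth_append)
  finally show ?thesis .
qed

lemma length_concat_replicate:
  "length (concat (map (\<lambda>i. replicate m (g i)) xs)) = m * length xs"
  by (induction xs) auto

lemma nth_concat_replicate:
  assumes "b < length xs" "j < m"
  shows "concat (map (\<lambda>i. replicate m (g i)) xs) ! (b * m + j) = g (xs ! b)"
  using assms
proof (induction xs arbitrary: b)
  case (Cons x xs)
  show ?case
  proof (cases b)
    case 0
    with Cons.prems show ?thesis by (simp add: nth_append)
  next
    case (Suc b')
    with Cons show ?thesis by (simp add: nth_append add.assoc)
  qed
qed simp

text \<open>Kept in the syntactic form of the prefix in \<open>slice\<close>, so that unfolding
  turns an iteration step into an oracle call at a \<open>chain_point\<close>.\<close>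

definition time_code :: "nat \<Rightarrow> nat \<Rightarrow> bool list" where
  "time_code l T = concat (map (\<lambda>i. replicate (rep_len l) (Bit (binary l T) i)) [1..<Suc l])"

lemma length_time_code: "length (time_code l T) = rep_len l * l"
  by (simp add: time_code_def length_concat_replicate del: upt_Suc)

lemma nth_time_code:
  assumes "b < l" "j < rep_len l"
  shows "time_code l T ! (b * rep_len l + j) = bit T b"
  using assms nth_concat_replicate[of b "[1..<Suc l]" j "rep_len l" "Bit (binary l T)"]
  by (simp add: time_code_def Bit_def binary_def del: upt_Suc)

lemma differing_bit:
  fixes T T' :: nat
  assumes "T < 2 ^ l" "T' < 2 ^ l" "T \<noteq> T'"
  obtains b where "b < l" "bit T b \<noteq> bit T' b"
proof -
  have "take_bit l T \<noteq> take_bit l T'"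
    using assms by (simp add: take_bit_nat_eq_self)
  then show ?thesis
    using that by (metis bit_eq_iff bit_take_bit_iff)
qed

text \<open>A single bit in which \<open>T\<close> and \<open>T'\<close> differ fills a block of
  \<open>rep_len l\<close> positions, all of which disagree, whatever follows the prefixes.\<close>

lemma time_code_separated:
  assumes "T < 2 ^ l" "T' < 2 ^ l" "T \<noteq> T'"
  shows "rep_len l \<le> hamming (time_code l T @ x) (time_code l T' @ y)"
proof -
  obtain b where b: "b < l" "bit T b \<noteq> bit T' b"
    using differing_bit[OF assms] .
  let ?I = "(+) (b * rep_len l) ` {..<rep_len l}"
  have lt: "b * rep_len l + j < rep_len l * l" if "j < rep_len l" for j
  proof -
    have "b * rep_len l + j < Suc b * rep_len l" using that by simp
    also have "\<dots> \<le> l * rep_len l" using b(1) by (intro mult_right_mono) auto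
    finally show ?thesis by (simp add: mult.commute)
  qed
  have "rep_len l = card ?I" by (simp add: card_image)
  also have "\<dots> \<le> hamming (time_code l T @ x) (time_code l T' @ y)"
    unfolding hamming_def
    using b lt by (intro card_mono) (auto simp: nth_append length_time_code nth_time_code trans_less_add1)
  finally show ?thesis .
qed

section \<open>The oracle built from a chain of supports\<close>

definition indicator_string :: "nat \<Rightarrow> nat set \<Rightarrow> bool list" where
  "indicator_string n S = map (\<lambda>k. k \<in> S) [0..<n]"

definition chain_point :: "nat \<Rightarrow> (nat \<Rightarrow> nat set) \<Rightarrow> nat \<Rightarrow> bool list" where
  "chain_point l S T = time_code l T @ indicator_string (2 ^ l) (S T)"

text \<open>The string \<open>X\<^sub>T\<close> is represented by its support \<open>S T\<close>.  At Hamming distance \<open>D\<close> from the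
  \<open>T\<close>-th point of the chain, the oracle answers with \<open>S (T + 1)\<close> deprived of its \<open>D\<close> smallest
  elements.\<close>

definition chain_oracle :: "nat \<Rightarrow> (nat \<Rightarrow> nat set) \<Rightarrow> nat \<Rightarrow> bool list \<Rightarrow> bool list" where
  "chain_oracle l S d q = map (\<lambda>k. \<exists>T<d. k \<in> S (Suc T) \<and>
     hamming q (chain_point l S T) \<le> card {j \<in> S (Suc T). j < k}) [0..<2 ^ l]"

lemma length_chain_point: "length (chain_point l S T) = in_len l"
  by (simp add: chain_point_def length_time_code indicator_string_def in_len_def)

lemma length_chain_oracle: "length (chain_oracle l S d q) = 2 ^ l"
  by (simp add: chain_oracle_def)

lemma card_below_less:
  fixes A :: "nat set"
  assumes "finite A" "k \<in> A"
  shows "card {j \<in> A. j < k} < card A"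
  using assms by (intro psubset_card_mono) auto

lemma card_below_strict_mono:
  fixes A :: "nat set"
  assumes "finite A" "k \<in> A" "k < k'"
  shows "card {j \<in> A. j < k} < card {j \<in> A. j < k'}"
  using assms by (intro psubset_card_mono) auto

lemma card_below_inj:
  fixes A :: "nat set"
  assumes "finite A" "k \<in> A" "k' \<in> A" "card {j \<in> A. j < k} = card {j \<in> A. j < k'}"
  shows "k = k'"
  using assms card_below_strict_mono[of A k k'] card_below_strict_mono[of A k' k]
  by (metis less_irrefl linorder_neqE_nat)

text \<open>Of the \<open>2 * 2 ^ l + 1\<close> between the two points, fewer than
  \<open>2 ^ l\<close> are spent reaching \<open>q\<close> and at most one moving on to
  \<open>q'\<close>. Adjacent queries serve the Lipschitz property; \<open>q' = q\<close> shows that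
  one query is near at most one point.\<close>

lemma chain_points_far:
  assumes "T < 2 ^ l" "T' < 2 ^ l" "T \<noteq> T'"
    and "length q = in_len l" "length q' = in_len l" "hamming q q' \<le> 1"
    and "hamming q (chain_point l S T) < 2 ^ l"
  shows "2 ^ l \<le> hamming q' (chain_point l S T')"
proof -
  have "2 * 2 ^ l + 1 \<le> hamming (chain_point l S T) (chain_point l S T')"
    using time_code_separated[OF assms(1-3)] by (simp add: chain_point_def rep_len_def)
  also have "\<dots> \<le> hamming (chain_point l S T) q + hamming q (chain_point l S T')"
    using assms by (intro hamming_triangle) (simp add: length_chain_point)
  also have "\<dots> \<le> hamming q (chain_point l S T) + (hamming q q' + hamming q' (chain_point l S T'))"
    using assms hamming_triangle[of q q' "chain_point l S T'"]
      hamming_commute[of q "chain_point l S T"] by (simp add: length_chain_point)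
  finally show ?thesis using assms(6,7) by linarith
qed

lemma card_below_bound:
  fixes A :: "nat set"
  assumes "A \<subseteq> {..<N}" "k \<in> A"
  shows "card {j \<in> A. j < k} < N"
proof -
  have "card {j \<in> A. j < k} < card A"
    using assms by (intro card_below_less) (auto intro: finite_subset)
  also have "\<dots> \<le> N" using card_mono[OF _ assms(1)] by simp
  finally show ?thesis .
qed

text \<open>Call \<open>card {j \<in> S (Suc T). j < k}\<close> the rank of \<open>k\<close>. Ranks
  are below \<open>2 ^ l\<close>, so adjacent queries can only react to the same \<open>T\<close>;
  there the distance moves by at most one and crosses at most one rank.\<close>

lemma chain_oracle_lipschitz:
  assumes sub: "\<And>T. T < d \<Longrightarrow> S (Suc T) \<subseteq> {..<2 ^ l}" and d: "d \<le> 2 ^ l"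
  shows "one_lipschitz (in_len l) (chain_oracle l S d)"
  unfolding one_lipschitz_def
proof (intro ballI impI)
  fix q q' assume q: "q \<in> cube (in_len l)" "q' \<in> cube (in_len l)" and h: "hamming q q' = 1"
  have len: "length q = in_len l" "length q' = in_len l" using q by (auto simp: cube_def)
  have h': "hamming q' q = 1" using h hamming_commute len by metis
  define active where "active x T k \<longleftrightarrow> T < d \<and> k \<in> S (Suc T) \<and>
    hamming x (chain_point l S T) \<le> card {j \<in> S (Suc T). j < k}" for x T k
  have near: "hamming x (chain_point l S T) < 2 ^ l" if "active x T k" for x T k
    using card_below_bound[of "S (Suc T)" "2 ^ l" k] sub that unfolding active_def by fastforce
  have uniq: "T = T'" if "active x T k" "active x' T' k'" "x \<in> {q, q'}" "x' \<in> {q, q'}" for x x' T T' k k'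
  proof (rule ccontr)
    assume "T \<noteq> T'"
    moreover have "hamming x x' \<le> 1" "length x = in_len l" "length x' = in_len l"
      using that h h' len by (auto simp: hamming_self)
    moreover have "T < 2 ^ l" "T' < 2 ^ l" using that d by (auto simp: active_def)
    ultimately have "2 ^ l \<le> hamming x' (chain_point l S T')"
      using chain_points_far near[OF that(1)] by blast
    with near[OF that(2)] show False by simp
  qed
  let ?D = "{k. k < 2 ^ l \<and> (\<exists>T. active q T k) \<noteq> (\<exists>T. active q' T k)}"
  have eq: "hamming (chain_oracle l S d q) (chain_oracle l S d q') = card ?D"
    unfolding hamming_def
    by (rule arg_cong[where f = card]) (auto simp: chain_oracle_def active_def)
  have "k = k'" if k: "k \<in> ?D" "k' \<in> ?D" for k k'
  proof -
    obtain T x where T: "active x T k" "x \<in> {q, q'}" using k(1) by blast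
    obtain T' x' where T': "active x' T' k'" "x' \<in> {q, q'}" using k(2) by blast
    have [simp]: "T' = T" using uniq[OF T(1) T'(1) T(2) T'(2)] by simp
    let ?r = "\<lambda>k. card {j \<in> S (Suc T). j < k}"
    let ?h = "\<lambda>x. hamming x (chain_point l S T)"
    have TS: "k \<in> S (Suc T)" "k' \<in> S (Suc T)" "T < d"
      using T(1) T'(1) by (auto simp: active_def)
    have ex: "(\<exists>T'. active y T' i) \<longleftrightarrow> active y T i" if "y \<in> {q, q'}" for y i
      using uniq[OF _ T(1) that T(2)] by blast
    have 1: "active q T k \<noteq> active q' T k" "active q T k' \<noteq> active q' T k'"
      using k ex by simp_all
    \<comment> \<open>Exactly one of the two distances exceeds the rank of \<open>i\<close>. As they
      differ by at most one, the rank is the smaller distance, hence the same for \<open>k\<close>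
      and \<open>k'\<close>.\<close>
    have 2: "(?h q \<le> ?r i) \<noteq> (?h q' \<le> ?r i)" if "i = k \<or> i = k'" for i
      using 1 TS that by (auto simp: active_def)
    have "?h q \<le> 1 + ?h q'" "?h q' \<le> 1 + ?h q"
      using hamming_triangle[of q q' "chain_point l S T"] hamming_triangle[of q' q "chain_point l S T"]
        h h' len by simp_all
    then have "?r k = ?r k'" using 2[of k] 2[of k'] by simp linarith
    moreover have "finite (S (Suc T))" using sub[OF TS(3)] finite_subset by blast
    ultimately show ?thesis using card_below_inj TS by blast
  qed
  then have "card ?D \<le> 1" by (auto simp: card_le_Suc0_iff_eq)
  then show "hamming (chain_oracle l S d q) (chain_oracle l S d q') \<le> 1" using eq by simp
qed

lemma chain_oracle_chain_point:
  assumes sub: "\<And>T. T < d \<Longrightarrow> S (Suc T) \<subseteq> {..<2 ^ l}" and d: "d \<le> 2 ^ l" and T: "T < d"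
  shows "chain_oracle l S d (chain_point l S T) = indicator_string (2 ^ l) (S (Suc T))"
proof -
  have "T' = T" if "T' < d" "k \<in> S (Suc T')"
    "hamming (chain_point l S T) (chain_point l S T') \<le> card {j \<in> S (Suc T'). j < k}" for T' k
  proof (rule ccontr)
    assume "T' \<noteq> T"
    then have "2 ^ l \<le> hamming (chain_point l S T) (chain_point l S T')"
      using that T d by (intro chain_points_far[of T _ _ "chain_point l S T"]) (auto simp: length_chain_point hamming_self)
    moreover have "card {j \<in> S (Suc T'). j < k} < 2 ^ l"
      using card_below_bound sub that by blast
    ultimately show False using that(3) by simp
  qed
  then show ?thesis
    using T unfolding chain_oracle_def indicator_string_def
    by (auto simp: hamming_self)
qed

lemma iterate_chain_oracle:
  assumes "\<And>T. T < d \<Longrightarrow> S (Suc T) \<subseteq> {..<2 ^ l}" "d \<le> 2 ^ l" "S 0 = {}" "T \<le> d"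
  shows "iterate l (chain_oracle l S d) T = indicator_string (2 ^ l) (S T)"
  using assms(4)
proof (induction T)
  case 0
  then show ?case using assms(3) by (simp add: indicator_string_def map_replicate_const)
next
  case (Suc T)
  then show ?case
    using chain_oracle_chain_point[of d S l T] assms(1,2)
    by (simp add: slice_def chain_point_def time_code_def del: upt_Suc)
qed

lemma chain_oracle_cong:
  assumes "\<And>T. T \<le> d \<Longrightarrow> S T = S' T"
  shows "chain_oracle l S d = chain_oracle l S' d"
  using assms unfolding chain_oracle_def chain_point_def by (intro ext) (auto simp: Suc_le_eq)

text \<open>Every rank in \<open>S (Suc d)\<close> is below its cardinality, so at this distance the
  whole set is erased and the answer carries no trace of it.\<close>

lemma chain_oracle_Suc_far:
  assumes "finite (S (Suc d))" "card (S (Suc d)) \<le> hamming q (chain_point l S d)"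
  shows "chain_oracle l S (Suc d) q = chain_oracle l S d q"
proof -
  have "\<not> hamming q (chain_point l S d) \<le> card {j \<in> S (Suc d). j < k}" if "k \<in> S (Suc d)" for k
    using card_below_less[OF assms(1) that] assms(2) by simp
  then show ?thesis
    unfolding chain_oracle_def by (auto simp: less_Suc_eq)
qed


section \<open>Circuit evaluation and nesting depth\<close>

definition oracle_query :: "circuit \<Rightarrow> (bool list \<Rightarrow> bool list) \<Rightarrow> nat \<Rightarrow> bool list" where
  "oracle_query C f i = map (wire_value (gate_values f (fst C))) (gate_wires (fst C ! i))"

lemma gate_values_snoc:
  "gate_values f (gs @ [g]) = gate_values f gs @ [gate_value f (gate_values f gs) g]"
  by (simp add: gate_values_def)

lemma length_gate_values: "length (gate_values f gs) = length gs"
  by (induction gs rule: rev_induct) (simp_all add: gate_values_snoc, simp add: gate_values_def)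

lemma gate_values_append: "\<exists>vs. gate_values f (gs @ hs) = gate_values f gs @ vs"
proof (induction hs rule: rev_induct)
  case (snoc g hs)
  then show ?case using gate_values_snoc[of f "gs @ hs" g] by auto
qed simp

lemma gate_value_cong:
  assumes "\<And>w. w \<in> set (gate_wires g) \<Longrightarrow> wire_value vs w = wire_value vs' w"
  shows "gate_value f vs g = gate_value f vs' g"
  using assms by (cases g) (auto cong: map_cong)

lemma feeds_less:
  assumes "wf_circuit N n C" "feeds C j i" "i < length (fst C)"
  shows "j < i"
  using assms unfolding feeds_def wf_circuit_def by (fastforce split: prod.splits)

text \<open>\<open>foldl\<close> evaluates gate \<open>i\<close> on the values of the preceding
  gates only; its wires point below \<open>i\<close>, so the complete list serves equally.\<close>

lemma gate_values_nth:
  assumes wf: "wf_circuit N n C" and i: "i < length (fst C)"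
  shows "gate_values f (fst C) ! i = gate_value f (gate_values f (fst C)) (fst C ! i)"
proof -
  let ?gs = "fst C"
  have "?gs = (take i ?gs @ [?gs ! i]) @ drop (Suc i) ?gs"
    using id_take_nth_drop[OF i] by simp
  then obtain vs where vs: "gate_values f ?gs = gate_values f (take i ?gs @ [?gs ! i]) @ vs"
    using gate_values_append by metis
  have len: "length (gate_values f (take i ?gs)) = i" using i by (simp add: length_gate_values)
  have "gate_values f ?gs ! i = gate_value f (gate_values f (take i ?gs)) (?gs ! i)"
    unfolding vs gate_values_snoc using len by (simp add: nth_append)
  also have "\<dots> = gate_value f (gate_values f ?gs) (?gs ! i)"
  proof (rule gate_value_cong)
    fix w assume "w \<in> set (gate_wires (?gs ! i))"
    then have "fst w < i" using feeds_less[OF wf _ i] by (auto simp: feeds_def)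
    then show "wire_value (gate_values f (take i ?gs)) w = wire_value (gate_values f ?gs) w"
      unfolding vs gate_values_snoc wire_value_def using len by (simp add: nth_append)
  qed
  finally show ?thesis .
qed

text \<open>Agreement is assumed only at the queries made under \<open>f\<close>. As
  \<open>D\<close> is closed under predecessors, induction along the gate order shows that
  \<open>f'\<close> is asked the same queries there.\<close>

lemma gate_values_agree:
  assumes wf: "wf_circuit N n C" and D: "D \<subseteq> {..<length (fst C)}"
    and closed: "\<And>i j. i \<in> D \<Longrightarrow> feeds C j i \<Longrightarrow> j \<in> D"
    and agree: "\<And>i. i \<in> D \<Longrightarrow> i \<in> oracle_gates C \<Longrightarrow> f' (oracle_query C f i) = f (oracle_query C f i)"
    and i: "i \<in> D"
  shows "gate_values f' (fst C) ! i = gate_values f (fst C) ! i"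
  using i
proof (induction i rule: less_induct)
  case (less i)
  have len: "i < length (fst C)" using D less.prems by auto
  have ws: "wire_value (gate_values f' (fst C)) w = wire_value (gate_values f (fst C)) w"
    if "w \<in> set (gate_wires (fst C ! i))" for w
  proof -
    have "feeds C (fst w) i" using that by (simp add: feeds_def)
    then show ?thesis
      using less closed feeds_less[OF wf _ len] by (simp add: wire_value_def)
  qed
  have "gate_value f' (gate_values f (fst C)) (fst C ! i) = gate_value f (gate_values f (fst C)) (fst C ! i)"
    using agree[OF less.prems] len
    by (cases "fst C ! i") (auto simp: oracle_gates_def is_oracle_def oracle_query_def)
  then show ?case
    using gate_value_cong[OF ws] gate_values_nth[OF wf len] by metis
qed

text \<open>A path to \<open>j\<close> with the most oracle gates, prolonged by \<open>i\<close>,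
  competes in the maximum for \<open>i\<close>.\<close>

lemma nesting_depth_feeds:
  assumes wf: "wf_circuit N n C" and N: "N > 0" and i: "i < length (fst C)" and j: "feeds C j i"
  shows "nesting_depth C j + (if is_oracle C i then 1 else 0) \<le> nesting_depth C i"
proof -
  let ?g = "\<lambda>p. length (filter (is_oracle C) p)"
  have jl: "j < length (fst C)" using feeds_less[OF wf j i] i by simp
  have "nesting_depth C j \<in> ?g ` input_paths C j"
    unfolding nesting_depth_def
    using finite_input_paths[OF wf] input_paths_nonempty[OF wf N jl] by (intro Max_in) auto
  then obtain p where p: "p \<in> input_paths C j" "nesting_depth C j = ?g p" by blast
  have "p @ [i] \<in> input_paths C i"
    using p(1) i j by (auto simp: input_paths_def successively_append_iff)
  then have "?g (p @ [i]) \<le> nesting_depth C i"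
    unfolding nesting_depth_def using finite_input_paths[OF wf]
    by (intro Max_ge finite_imageI imageI)
  then show ?thesis using p(2) by (simp split: if_splits)
qed

lemma length_oracle_query:
  assumes "wf_circuit N n C" "i \<in> oracle_gates C"
  shows "length (oracle_query C f i) = N"
  using assms by (fastforce simp: wf_circuit_def oracle_gates_def is_oracle_def oracle_query_def split: prod.splits)

lemma nesting_depth_pos:
  assumes wf: "wf_circuit N n C" and N: "N > 0" and i: "i \<in> oracle_gates C"
  shows "nesting_depth C i > 0"
proof -
  have "gate_wires (fst C ! i) \<noteq> []"
    using length_oracle_query[OF wf i] N by (auto simp: oracle_query_def)
  then obtain j where "feeds C j i"
    unfolding feeds_def by (metis ex_in_conv image_is_empty set_empty)
  then show ?thesis
    using nesting_depth_feeds[OF wf N, of i j] i by (auto simp: oracle_gates_def)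
qed

text \<open>The gate counts itself in its depth, so all gates feeding it have depth at most
  \<open>d\<close>. Answers up to depth \<open>d\<close> therefore fix the queries up to depth
  \<open>d + 1\<close>.\<close>

lemma oracle_query_agree:
  assumes wf: "wf_circuit N n C" and N: "N > 0"
    and agree: "\<And>i. i \<in> oracle_gates C \<Longrightarrow> nesting_depth C i \<le> d \<Longrightarrow>
      f' (oracle_query C f i) = f (oracle_query C f i)"
    and i: "i \<in> oracle_gates C" "nesting_depth C i \<le> Suc d"
  shows "oracle_query C f' i = oracle_query C f i"
proof -
  let ?D = "{j. j < length (fst C) \<and> nesting_depth C j \<le> d}"
  have len: "i < length (fst C)" "is_oracle C i" using i by (auto simp: oracle_gates_def)
  have closed: "j \<in> ?D" if "k \<in> ?D" "feeds C j k" for k j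
    using that nesting_depth_feeds[OF wf N _ that(2)] feeds_less[OF wf that(2)]
    by (auto split: if_splits)
  have "wire_value (gate_values f' (fst C)) w = wire_value (gate_values f (fst C)) w"
    if "w \<in> set (gate_wires (fst C ! i))" for w
  proof -
    have j: "feeds C (fst w) i" using that by (simp add: feeds_def)
    then have "fst w \<in> ?D"
      using nesting_depth_feeds[OF wf N len(1) j] feeds_less[OF wf j len(1)] len i(2) by auto
    then have "gate_values f' (fst C) ! fst w = gate_values f (fst C) ! fst w"
      using agree by (intro gate_values_agree[OF wf _ closed]) auto
    then show ?thesis by (simp add: wire_value_def)
  qed
  then show ?thesis by (simp add: oracle_query_def)
qed

lemma circuit_output_agree:
  assumes wf: "wf_circuit N n C"
    and agree: "\<And>i. i \<in> oracle_gates C \<Longrightarrow> f' (oracle_query C f i) = f (oracle_query C f i)"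
  shows "circuit_output C f' = circuit_output C f"
proof -
  have "gate_values f' (fst C) ! fst (snd C) = gate_values f (fst C) ! fst (snd C)"
  proof (rule gate_values_agree[OF wf, of "{..<length (fst C)}"])
    show "j \<in> {..<length (fst C)}" if "i \<in> {..<length (fst C)}" "feeds C j i" for i j
      using feeds_less[OF wf that(2)] that(1) by auto
    show "fst (snd C) \<in> {..<length (fst C)}"
      using wf by (auto simp: wf_circuit_def split: prod.splits)
  qed (use agree in auto)
  then show ?thesis by (simp add: circuit_output_def wire_value_def)
qed

section \<open>Supports far from many given sets\<close>

text \<open>Greedy choice of one point per block of \<open>z\<^sup>2\<close> positions: averaged over the points of a new
  block, the potential does not increase.\<close>

lemma block_transversal:
  fixes Y :: "'i \<Rightarrow> nat set" and z :: nat
  assumes z: "z \<ge> 2"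
  shows "\<exists>S \<subseteq> {..<w * z\<^sup>2}. card S = w \<and>
    (\<Sum>i\<in>I. real z ^ (2 * card (S \<inter> Y i)) / real z ^ card (Y i \<inter> {..<w * z\<^sup>2})) \<le> real (card I)"
proof (induction w)
  case 0
  show ?case by (intro exI[of _ "{}"]) simp
next
  case (Suc w)
  then obtain S where S: "S \<subseteq> {..<w * z\<^sup>2}" "card S = w" and
    pot: "(\<Sum>i\<in>I. real z ^ (2 * card (S \<inter> Y i)) / real z ^ card (Y i \<inter> {..<w * z\<^sup>2})) \<le> real (card I)"
    by blast
  define K where "K = {w * z\<^sup>2..<Suc w * z\<^sup>2}"
  have fin: "finite S" using S(1) finite_subset by blast
  have K: "finite K" "card K = z\<^sup>2" "K \<noteq> {}" "S \<inter> K = {}" "{..<Suc w * z\<^sup>2} = {..<w * z\<^sup>2} \<union> K"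
    using S(1) z by (auto simp: K_def)
  define \<phi> where "\<phi> i = real z ^ (2 * card (S \<inter> Y i)) / real z ^ card (Y i \<inter> {..<w * z\<^sup>2})" for i
  \<comment> \<open>A hit multiplies the term of \<open>i\<close> by \<open>z ^ 2\<close>; each
    point of \<open>Y i\<close> in the new block divides it by \<open>z\<close>, hit or not.\<close>
  define g where "g p i = (if p \<in> Y i then real z ^ 2 else 1) / real z ^ card (Y i \<inter> K)" for p i
  have step: "real z ^ (2 * card (insert p S \<inter> Y i)) / real z ^ card (Y i \<inter> {..<Suc w * z\<^sup>2}) = \<phi> i * g p i"
    if "p \<in> K" for p i
  proof -
    have "card (Y i \<inter> {..<Suc w * z\<^sup>2}) = card (Y i \<inter> {..<w * z\<^sup>2}) + card (Y i \<inter> K)"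
      unfolding K(5) Int_Un_distrib using K(1) by (intro card_Un_disjoint) (auto simp: K_def)
    moreover have "card (insert p S \<inter> Y i) = card (S \<inter> Y i) + (if p \<in> Y i then 1 else 0)"
    proof -
      have "p \<notin> S" using that K(4) by blast
      then show ?thesis using fin by (simp add: Int_insert_left)
    qed
    ultimately show ?thesis
      by (simp add: \<phi>_def g_def power_add power_mult power2_eq_square)
  qed
  \<comment> \<open>If \<open>Y i\<close> has \<open>y\<close> points in the block, these contribute
    \<open>y * z ^ 2\<close> and the others at most \<open>card K = z ^ 2\<close>. The average is
    thus at most \<open>(y + 1) / z ^ y\<close>, which is at most 1 for
    \<open>z \<ge> 2\<close>.\<close>
  have avg: "(\<Sum>p\<in>K. g p i) \<le> real (card K)" for i
  proof -
    define y where "y = card (Y i \<inter> K)"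
    have "(\<Sum>p\<in>K. if p \<in> Y i then real z ^ 2 else 1) = real y * real z ^ 2 + real (card (K - Y i))"
      using K(1) by (simp add: sum.If_cases y_def Int_commute Diff_eq)
    also have "\<dots> \<le> real y * real z ^ 2 + real (card K)"
      using K(1) by (simp add: card_mono)
    also have "\<dots> = real z ^ 2 * real (Suc y)" using K(2) by (simp add: algebra_simps)
    also have "\<dots> \<le> real z ^ 2 * real z ^ y"
    proof -
      have "Suc y \<le> 2 ^ y" by (simp add: Suc_leI)
      also have "\<dots> \<le> z ^ y" using z by (intro power_mono) auto
      finally have "real (Suc y) \<le> real z ^ y" by (metis of_nat_le_iff of_nat_power)
      then show ?thesis by (intro mult_left_mono) auto
    qed
    finally show ?thesis
      using z K(2) unfolding g_def y_def[symmetric] sum_divide_distrib[symmetric]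
      by (simp add: divide_le_eq)
  qed
  have "(\<Sum>p\<in>K. \<Sum>i\<in>I. \<phi> i * g p i) = (\<Sum>i\<in>I. \<phi> i * (\<Sum>p\<in>K. g p i))"
    by (subst sum.swap) (simp add: sum_distrib_left)
  also have "\<dots> \<le> (\<Sum>i\<in>I. \<phi> i * real (card K))"
    using avg by (intro sum_mono mult_left_mono) (auto simp: \<phi>_def)
  also have "\<dots> \<le> (\<Sum>p\<in>K. real (card I))"
    using mult_right_mono[OF pot[folded \<phi>_def], of "real (card K)"]
    by (simp add: sum_distrib_right mult.commute)
  finally obtain p where p: "p \<in> K" "(\<Sum>i\<in>I. \<phi> i * g p i) \<le> real (card I)"
    using K(1,3) sum_strict_mono[of K "\<lambda>_. real (card I)" "\<lambda>p. \<Sum>i\<in>I. \<phi> i * g p i"]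
    by (meson leD not_le_imp_less)
  have "insert p S \<subseteq> {..<Suc w * z\<^sup>2}" using S(1) p(1) K(5) by blast
  moreover have "card (insert p S) = Suc w" using S(2) fin p(1) K(4) by (subst card_insert_disjoint) auto
  ultimately show ?case
    using p step[OF p(1)] by (intro exI[of _ "insert p S"]) simp
qed

text \<open>With \<open>a\<close> points of \<open>S\<close> in \<open>Y i\<close> and
  \<open>b\<close> points of \<open>Y i\<close> in the blocks, the potential of \<open>i\<close> is
  \<open>z ^ (2 * a) / z ^ b\<close>. It is below \<open>z ^ r\<close>, so
  \<open>2 * a < r + b\<close>, and the symmetric difference has at least
  \<open>(w - a) + (b - a)\<close> elements.\<close>

lemma far_support:
  fixes Y :: "'i \<Rightarrow> nat set" and z :: nat
  assumes z: "z \<ge> 2" and I: "finite I" "card I < z ^ r" and n: "w * z\<^sup>2 \<le> n"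
  shows "\<exists>S \<subseteq> {..<n}. card S = w \<and> (\<forall>i\<in>I. w \<le> card {k. k < n \<and> (k \<in> Y i) \<noteq> (k \<in> S)} + r)"
proof -
  obtain S where S: "S \<subseteq> {..<w * z\<^sup>2}" "card S = w" and
    pot: "(\<Sum>i\<in>I. real z ^ (2 * card (S \<inter> Y i)) / real z ^ card (Y i \<inter> {..<w * z\<^sup>2})) \<le> real (card I)"
    using block_transversal[OF z, of w Y I] by blast
  have fin: "finite S" using S(1) finite_subset by blast
  have "w \<le> card {k. k < n \<and> (k \<in> Y i) \<noteq> (k \<in> S)} + r" if i: "i \<in> I" for i
  proof -
    let ?B = "Y i \<inter> {..<w * z\<^sup>2}"
    define a b where "a = card (S \<inter> Y i)" and "b = card ?B"
    have "real z ^ (2 * a) / real z ^ b \<le> real (card I)"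
      using member_le_sum[OF i, of "\<lambda>i. real z ^ (2 * card (S \<inter> Y i)) / real z ^ card (Y i \<inter> {..<w * z\<^sup>2})"] I(1) pot
      by (simp add: a_def b_def)
    also have "\<dots> < real z ^ r" using I(2) by (metis of_nat_less_iff of_nat_power)
    finally have "real z ^ (2 * a) < real z ^ (r + b)"
      using z by (simp add: divide_less_eq power_add)
    then have ab: "2 * a < r + b" using z by (simp add: power_strict_increasing_iff)
    have "card (S - Y i) = w - a" "a \<le> w"
      using fin S(2) by (auto simp: a_def card_Diff_subset_Int card_mono)
    moreover have "card (?B - S) = b - a" "a \<le> b"
    proof -
      have "?B \<inter> S = S \<inter> Y i" using S(1) by auto
      then show "card (?B - S) = b - a"
        using card_Diff_subset_Int[of ?B S] fin by (simp add: a_def b_def)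
      show "a \<le> b" unfolding a_def b_def using S(1) by (intro card_mono) auto
    qed
    moreover have "card (S - Y i) + card (?B - S) \<le> card {k. k < n \<and> (k \<in> Y i) \<noteq> (k \<in> S)}"
    proof -
      have "card (S - Y i) + card (?B - S) = card ((S - Y i) \<union> (?B - S))"
        using fin by (intro card_Un_disjoint[symmetric]) auto
      also have "\<dots> \<le> card {k. k < n \<and> (k \<in> Y i) \<noteq> (k \<in> S)}"
        using S(1) n by (intro card_mono) auto
      finally show ?thesis .
    qed
    ultimately show ?thesis using ab by linarith
  qed
  moreover have "S \<subseteq> {..<n}" using S(1) n by auto
  ultimately show ?thesis using S(2) by blast
qed

section \<open>The adversary chain and the failure of the circuit\<close>

text \<open>The distance \<open>w (Suc d)\<close> is the size of the support chosen next, so by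
  \<open>chain_oracle_Suc_far\<close> that support can be adjoined without changing an answer up to
  depth \<open>d\<close>.\<close>

lemma hidden_chain:
  fixes w :: "nat \<Rightarrow> nat" and z :: nat
  assumes wf: "wf_circuit (in_len l) (2 ^ l) C" and z: "z \<ge> 2"
    and card: "card (oracle_gates C) < z ^ r"
    and w_le: "\<And>T. 1 \<le> T \<Longrightarrow> T \<le> d \<Longrightarrow> w T * z\<^sup>2 \<le> 2 ^ l"
    and w_dec: "\<And>T. 1 \<le> T \<Longrightarrow> T \<le> d \<Longrightarrow> w (Suc T) + r \<le> w T"
  shows "\<exists>S. S 0 = {} \<and> (\<forall>T\<le>d. S T \<subseteq> {..<2 ^ l}) \<and>
    (\<forall>i\<in>oracle_gates C. nesting_depth C i \<le> d \<longrightarrow>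
      w (Suc d) \<le> hamming (oracle_query C (chain_oracle l S d) i) (chain_point l S d))"
  using w_le w_dec
proof (induction d)
  case 0
  have "in_len l > 0" by (simp add: in_len_def)
  \<comment> \<open>An oracle gate counts itself, so none has depth 0 and the claim is
    vacuous.\<close>
  then show ?case using nesting_depth_pos[OF wf] by (intro exI[of _ "\<lambda>_. {}"]) fastforce
next
  case (Suc d)
  have N: "in_len l > 0" by (simp add: in_len_def)
  from Suc obtain S where S: "S 0 = {}" "\<forall>T\<le>d. S T \<subseteq> {..<2 ^ l}" and
    far: "\<And>i. i \<in> oracle_gates C \<Longrightarrow> nesting_depth C i \<le> d \<Longrightarrow>
      w (Suc d) \<le> hamming (oracle_query C (chain_oracle l S d) i) (chain_point l S d)"
    by fastforce
  define q where "q i = oracle_query C (chain_oracle l S d) i" for i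
  have "finite (oracle_gates C)" by (simp add: oracle_gates_def)
  \<comment> \<open>All oracle gates are avoided at once, with the queries they ask before
    \<open>A\<close> is adjoined. These queries are shown to persist up to depth
    \<open>d + 1\<close>.\<close>
  then obtain A where A: "A \<subseteq> {..<2 ^ l}" "card A = w (Suc d)" and
    A_far: "\<And>i. i \<in> oracle_gates C \<Longrightarrow>
      w (Suc d) \<le> card {k. k < 2 ^ l \<and> (k \<in> {k. q i ! (rep_len l * l + k)}) \<noteq> (k \<in> A)} + r"
    using far_support[OF z _ card, of "w (Suc d)" "2 ^ l" "\<lambda>i. {k. q i ! (rep_len l * l + k)}"]
      Suc.prems(1)[of "Suc d"] by auto
  define S' where "S' = S(Suc d := A)"
  have S'_d: "chain_oracle l S' d = chain_oracle l S d" "chain_point l S' d = chain_point l S d"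
    by (auto simp: S'_def chain_point_def intro!: chain_oracle_cong)
  have A_S': "S' (Suc d) = A" "finite A" using A(1) finite_subset by (auto simp: S'_def)
  have agree: "chain_oracle l S' (Suc d) (q i) = chain_oracle l S d (q i)"
    if "i \<in> oracle_gates C" "nesting_depth C i \<le> d" for i
    using chain_oracle_Suc_far[of S' d "q i" l] far[OF that] A(2) A_S' S'_d
    by (simp add: q_def)
  have "w (Suc (Suc d)) \<le> hamming (oracle_query C (chain_oracle l S' (Suc d)) i) (chain_point l S' (Suc d))"
    if i: "i \<in> oracle_gates C" "nesting_depth C i \<le> Suc d" for i
  proof -
    have eq: "oracle_query C (chain_oracle l S' (Suc d)) i = q i"
      unfolding q_def using agree[unfolded q_def] i by (intro oracle_query_agree[OF wf N]) auto
    have len: "length (q i) = in_len l" using length_oracle_query[OF wf i(1)] by (simp add: q_def)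
    \<comment> \<open>Only mismatches behind the time prefix are counted; the decrease of
      \<open>w\<close> by at least \<open>r\<close> absorbs the loss in
      \<open>far_support\<close>.\<close>
    have "w (Suc (Suc d)) \<le> card {k. k < 2 ^ l \<and> q i ! (rep_len l * l + k) \<noteq> (k \<in> A)}"
      using A_far[OF i(1)] Suc.prems(2)[of "Suc d"] by simp
    also have "{k. k < 2 ^ l \<and> q i ! (rep_len l * l + k) \<noteq> (k \<in> A)} =
        {k. k < length (indicator_string (2 ^ l) A) \<and>
          q i ! (length (time_code l (Suc d)) + k) \<noteq> indicator_string (2 ^ l) A ! k}"
      by (auto simp: indicator_string_def length_time_code)
    also have "card \<dots> \<le> hamming (q i) (time_code l (Suc d) @ indicator_string (2 ^ l) A)"
      using len by (intro hamming_append_ge) (simp add: length_time_code indicator_string_def in_len_def)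
    finally show ?thesis using eq A_S' by (simp add: chain_point_def)
  qed
  moreover have "S' 0 = {}" "\<forall>T\<le>Suc d. S' T \<subseteq> {..<2 ^ l}"
    using S A(1) by (auto simp: S'_def le_Suc_eq)
  ultimately show ?case by blast
qed

text \<open>The last support is left open between \<open>{}\<close> and \<open>{0}\<close>. Both are
  too small to be seen by any query, so the circuit gives the same output on the two oracles, while
  \<open>F\<close> differs.\<close>

lemma circuit_fails:
  fixes z :: nat
  assumes wf: "wf_circuit (in_len l) (2 ^ l) C" and z: "z \<ge> 2"
    and card: "card (oracle_gates C) < z ^ r"
    and s: "s = nat \<lfloor>sqrt (2 ^ l)\<rfloor>" "s \<ge> 1" "s \<le> 2 ^ l" and r: "r \<ge> 1" and fit: "r * s * z\<^sup>2 \<le> 2 ^ l"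
    and depth: "\<forall>i\<in>oracle_gates C. nesting_depth C i < s"
  shows "\<exists>f \<in> cube (in_len l) \<rightarrow> cube (2 ^ l). one_lipschitz (in_len l) f \<and> circuit_output C f \<noteq> F l f"
proof -
  obtain d where d: "s = Suc d" using s(2) by (cases s) auto
  \<comment> \<open>The sizes run from \<open>w 1 = r * s\<close>, which \<open>fit\<close>
    accommodates, down to \<open>w s = r\<close>, still at least the size of
    \<open>{0}\<close>.\<close>
  define w where "w T = r * (Suc s - T)" for T
  have w_le: "w T * z\<^sup>2 \<le> 2 ^ l" if "1 \<le> T" for T
  proof -
    have "w T * z\<^sup>2 \<le> r * s * z\<^sup>2" using that by (auto simp: w_def)
    then show ?thesis using fit by linarith
  qed
  have w_dec: "w (Suc T) + r \<le> w T" if "T \<le> d" for T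
  proof -
    have "Suc s - T = Suc (Suc s - Suc T)" using that d by simp
    then show ?thesis by (simp add: w_def)
  qed
  \<comment> \<open>Stopping at \<open>d = s - 1\<close> covers every oracle gate, since the depths
    are strictly below \<open>s\<close>.\<close>
  obtain S where S: "S 0 = {}" "\<forall>T\<le>d. S T \<subseteq> {..<2 ^ l}" and
    far: "\<And>i. i \<in> oracle_gates C \<Longrightarrow> nesting_depth C i \<le> d \<Longrightarrow>
      w (Suc d) \<le> hamming (oracle_query C (chain_oracle l S d) i) (chain_point l S d)"
    using hidden_chain[of l C z r d w, OF wf z card w_le w_dec] by metis
  define g where "g A = chain_oracle l (S(s := A)) s" for A
  have sub: "(S(s := A)) (Suc T) \<subseteq> {..<2 ^ l}" if "A \<subseteq> {0}" "T < s" for A T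
    using S(2) that d by auto
  have out: "circuit_output C (g A) = circuit_output C (chain_oracle l S d)" if A: "A \<subseteq> {0}" for A
  proof (rule circuit_output_agree[OF wf])
    fix i assume i: "i \<in> oracle_gates C"
    let ?S = "S(s := A)" and ?q = "oracle_query C (chain_oracle l S d) i"
    have eq: "chain_oracle l ?S d = chain_oracle l S d" "chain_point l ?S d = chain_point l S d"
      by (auto simp: d chain_point_def intro!: chain_oracle_cong)
    have "finite A" using A finite_subset by blast
    moreover have "card A \<le> 1" using card_mono[OF _ A] by simp
    moreover have "1 \<le> w (Suc d)" using r by (simp add: w_def d)
    ultimately show "g A ?q = chain_oracle l S d ?q"
      using chain_oracle_Suc_far[of ?S d ?q l] far[OF i] depth i eq unfolding g_def
      by (fastforce simp: d less_Suc_eq_le)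
  qed
  have F: "F l (g A) \<longleftrightarrow> 0 \<in> A" if A: "A \<subseteq> {0}" for A
    unfolding F_def s(1)[symmetric] g_def
    using iterate_chain_oracle[of s "S(s := A)" l s] sub[OF A] s(2,3) S(1)
    by (auto simp: Bit_def indicator_string_def)
  have lip: "one_lipschitz (in_len l) (g A)" if "A \<subseteq> {0}" for A
    unfolding g_def using sub[OF that] s(3) by (intro chain_oracle_lipschitz) auto
  have cub: "g A \<in> cube (in_len l) \<rightarrow> cube (2 ^ l)" for A
    by (auto simp: g_def cube_def length_chain_oracle)
  have "circuit_output C (g {}) = circuit_output C (g {0})" "F l (g {}) \<noteq> F l (g {0})"
    using out F by simp_all
  then have "circuit_output C (g {}) \<noteq> F l (g {}) \<or> circuit_output C (g {0}) \<noteq> F l (g {0})"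
    by blast
  then show ?thesis using lip cub by blast
qed

section \<open>Choice of the parameters\<close>

theorem theorem28:
  fixes a :: real
  assumes "a > 0"
  shows "\<exists>n\<^sub>0::nat. \<forall>n\<ge>n\<^sub>0. \<forall>l::nat. n = 2 ^ l \<longrightarrow>
    (\<forall>C. wf_circuit (in_len l) n C \<and>
         real (card (oracle_gates C)) \<le> real n powr a \<and>
         (\<forall>i\<in>oracle_gates C. nesting_depth C i < nat \<lfloor>sqrt (real n)\<rfloor>) \<longrightarrow>
      (\<exists>f \<in> cube (in_len l) \<rightarrow> cube n.
         one_lipschitz (in_len l) f \<and> circuit_output C f \<noteq> F l f))"
proof -
  \<comment> \<open>The 16 matches \<open>l < 16 * k\<close> below: it gives
    \<open>l * a < k * r\<close>, hence \<open>n powr a < (2 ^ k) ^ r\<close>.\<close>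
  define r where "r = Suc (nat \<lceil>16 * a\<rceil>)"
  have r: "16 * a \<le> real r" "r \<ge> 1" using real_nat_ceiling_ge[of "16 * a"] by (auto simp: r_def)
  \<comment> \<open>The threshold gives \<open>8 * r \<le> l\<close>, hence \<open>r \<le> k\<close>
    for \<open>k = l div 8\<close>. The base \<open>z = 2 ^ k\<close>, roughly the eighth root of
    \<open>n\<close>, is then at least 2 and at least \<open>r\<close>.\<close>
  show ?thesis
  proof (intro exI[of _ "2 ^ (8 * r)"] allI impI, elim conjE)
    fix n l C
    assume n: "2 ^ (8 * r) \<le> n" "n = 2 ^ l" and wf: "wf_circuit (in_len l) n C"
      and card: "real (card (oracle_gates C)) \<le> real n powr a"
      and depth: "\<forall>i\<in>oracle_gates C. nesting_depth C i < nat \<lfloor>sqrt (real n)\<rfloor>"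
    define k where "k = l div 8"
    define s where "s = nat \<lfloor>sqrt (2 ^ l)\<rfloor>"
    have l: "8 * r \<le> l" using n by (simp add: power_increasing_iff)
    have "l < 8 * k + 8" unfolding k_def by linarith
    moreover have "r \<le> k" "8 * k \<le> l" using l unfolding k_def by linarith+
    ultimately have k: "r \<le> k" "8 * k \<le> l" "l < 16 * k" using r(2) by linarith+
    have "real s \<le> sqrt (2 ^ l)" by (simp add: s_def)
    then have "real s ^ 2 \<le> 2 ^ l" using real_le_lsqrt sqrt_ge_absD by fastforce
    then have s2: "s\<^sup>2 \<le> 2 ^ l" by (metis of_nat_le_iff of_nat_numeral of_nat_power)
    have "1 \<le> sqrt (2 ^ l)" by simp
    then have s1: "s \<ge> 1" unfolding s_def by linarith
    have "s \<le> s\<^sup>2" by (simp add: power2_eq_square)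
    with s2 have s3: "s \<le> 2 ^ l" by linarith
    \<comment> \<open>Squaring brings in the bound of the square of \<open>s\<close> by
      \<open>2 ^ l\<close>. The left side becomes at most \<open>2 ^ (6 * k + l)\<close>, and
      \<open>8 * k \<le> l\<close> suffices.\<close>
    have "r * s * (2 ^ k)\<^sup>2 \<le> 2 ^ l"
    proof -
      have "r \<le> 2 ^ k" using k(1) less_exp[of k] by linarith
      then have "r\<^sup>2 \<le> (2 ^ k)\<^sup>2" by (intro power_mono) auto
      then have "(r * s * (2 ^ k)\<^sup>2)\<^sup>2 \<le> (2 ^ k)\<^sup>2 * 2 ^ l * ((2 ^ k)\<^sup>2)\<^sup>2"
        using s2 by (simp only: power_mult_distrib) (intro mult_mono, auto)
      also have "\<dots> = 2 ^ (6 * k + l)" by (simp flip: power_add power_mult)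
      also have "\<dots> \<le> 2 ^ (2 * l)" using k by (intro power_increasing) auto
      also have "\<dots> = (2 ^ l)\<^sup>2" by (simp add: power_mult[symmetric] mult.commute)
      finally show ?thesis by (simp add: power2_nat_le_eq_le)
    qed
    moreover have "card (oracle_gates C) < (2 ^ k) ^ r"
    proof -
      have "real n powr a = 2 powr (real l * a)"
        using n(2) by (simp add: powr_powr flip: powr_realpow)
      also have "\<dots> < 2 powr (real (k * r))"
      proof -
        have "real l * a < real (16 * k) * a" using k(3) assms by (intro mult_strict_right_mono) auto
        also have "\<dots> = real k * (16 * a)" by simp
        also have "\<dots> \<le> real k * real r" using r(1) by (intro mult_left_mono) auto
        finally show ?thesis by simp
      qed
      also have "\<dots> = real ((2 ^ k) ^ r)" by (subst powr_realpow) (simp_all add: power_mult)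
      finally show ?thesis using card by linarith
    qed
    moreover have "(2::nat) \<le> 2 ^ k" using k(1) r(2) self_le_power[of 2 k] by simp
    ultimately show "\<exists>f \<in> cube (in_len l) \<rightarrow> cube n.
        one_lipschitz (in_len l) f \<and> circuit_output C f \<noteq> F l f"
      using circuit_fails[of l C "2 ^ k" r s] wf depth s1 s3 r(2) s_def n(2) by simp
  qed
qed

end
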